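(* Let $R$ be a rotational surface in $\mathbb{E}^3$ given by $\Phi(s,\theta)=(f(s)\cos\theta,f(s)\sin\theta,g(s))$ with $f'^2+g'^2=1$, and let $\alpha$ be the loxodrome on $R$ given by $$\alpha(t)=\big(f(s(t))\cos\theta(t),\ f(s(t))\sin\theta(t),\ g(s(t))\big),\quad s(t)=(\cos\psi)t+c,\quad \theta(t)=\varepsilon\sin\psi\int_{t_0}^{t}\frac{d\xi}{f(s(\xi))},$$ with constants $c,t_0$, $\psi\in[0,\pi]$ and $\varepsilon=\pm1$. Then the curvature and the torsion of the loxodrome $\alpha$ are given by $$\kappa=\sqrt{\frac{a^4f''^2}{1-f'^2}+\frac{b^4+a^2b^2f'^2}{f^2}-\frac{2a^2b^2f''}{f}},$$ $$\begin{aligned}\tau=-\frac{ab}{\kappa^2f^3(1-f'^2)^{3/2}}\Big(&-b^2(1-f'^2)^2(b^2+a^2f'^2)+a^2ff''(1-f'^2)\big(3b^2+(a^2-2b^2)f'^2\big)\\&+a^2f^2f''^2(-2a^2+b^2+3a^2f'^2)-a^4f^3f''^3+a^2f^2f'f'''(1-f'^2)\Big),\end{aligned}$$ where $f$ denotes the smooth function $f(s(t))$, $a=\cos\psi$ and $b=\varepsilon\sin\psi$.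
   Context: $\Phi$ is an immersion, and the profile curve of $R$, with components $f,g$, is parametrized by arc length $s$. Primes denote $d/ds$; $f',f'',f'''$ are evaluated at $s(t)$. A loxodrome is a curve on $R$ meeting the meridians (the curves $\theta=$ const) at a constant angle, here $\psi$; $t$ is the arc-length parameter of $\alpha$. For a regular curve, $\kappa=\|\dot\alpha\times\ddot\alpha\|/\|\dot\alpha\|^3$ and $\tau=\det(\dot\alpha,\ddot\alpha,\dddot\alpha)/\|\dot\alpha\times\ddot\alpha\|^2$.
   Formalization: The torsion formula is proved where g' > 0; where g' < 0 it is proved with the opposite sign, since as printed it fails there (e.g. cylinder f = r, g(s) = -s). Points with f'^2 = 1, where the formulas divide by zero, are excluded. *)

theory Defs
  imports "HOL-Analysis.Analysis"
begin

(* Intended for open A; being C-infinity on A then means that all iterated derivatives are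
   differentiable at every point of A. *)
definition smooth_on :: "real set \<Rightarrow> (real \<Rightarrow> real) \<Rightarrow> bool" where
  "smooth_on A h \<longleftrightarrow> (\<forall>n. \<forall>x\<in>A. (deriv ^^ n) h differentiable (at x))"

(* Only the injectivity of the differential; smoothness of the map is required separately. *)
definition immersion_on ::
  "'a::real_normed_vector set \<Rightarrow> ('a \<Rightarrow> 'b::real_normed_vector) \<Rightarrow> bool" where
  "immersion_on U F \<longleftrightarrow> (\<forall>p\<in>U. \<exists>D. (F has_derivative D) (at p) \<and> inj D)"

definition rot_surface :: "(real \<Rightarrow> real) \<Rightarrow> (real \<Rightarrow> real) \<Rightarrow> real \<times> real \<Rightarrow> real^3" where
  "rot_surface f g = (\<lambda>(s, \<theta>). vector [f s * cos \<theta>, f s * sin \<theta>, g s])"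

definition vderiv :: "(real \<Rightarrow> real^3) \<Rightarrow> real \<Rightarrow> real^3" where
  "vderiv \<alpha> = (\<lambda>t. vector_derivative \<alpha> (at t))"

definition curvature :: "(real \<Rightarrow> real^3) \<Rightarrow> real \<Rightarrow> real" where
  "curvature \<alpha> t =
     norm (cross3 (vderiv \<alpha> t) ((vderiv ^^ 2) \<alpha> t)) / norm (vderiv \<alpha> t) ^ 3"

(* Geometrically meaningful only where the curvature is nonzero; by x / 0 = 0 it is 0 elsewhere. *)
definition torsion :: "(real \<Rightarrow> real^3) \<Rightarrow> real \<Rightarrow> real" where
  "torsion \<alpha> t =
     det (vector [vderiv \<alpha> t, (vderiv ^^ 2) \<alpha> t, (vderiv ^^ 3) \<alpha> t] :: real^3^3) /
     norm (cross3 (vderiv \<alpha> t) ((vderiv ^^ 2) \<alpha> t)) ^ 2"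

end

theory Submission
  imports Defs
begin

text \<open>
  Write the loxodrome in the rotating orthonormal frame \<open>e\<^sub>r\<close>, \<open>e\<^sub>\<theta>\<close>, \<open>e\<^sub>z\<close>, where differentiation
  along a curve of angular velocity \<open>\<omega>\<close> acts on coordinates by
  \<open>(p, q, r) \<mapsto> (p' - \<omega> q, q' + \<omega> p, r')\<close>. Since \<open>\<theta>' = b / f\<close>, the first three derivatives of the curve
  have coordinates that are rational in \<open>f\<close>, \<open>g\<close> and their derivatives, and cross products and
  determinants may be computed in the frame. The derivatives of \<open>g\<close> are then eliminated by
  differentiating \<open>f'\<^sup>2 + g'\<^sup>2 = 1\<close> twice.
\<close>

section \<open>Vector algebra in the frame e_r = (cos \<theta>, sin \<theta>, 0), e_\<theta> = (-sin
  \<theta>, cos \<theta>, 0), e_z = (0, 0, 1)\<close>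

definition rot_frame :: "real \<Rightarrow> real \<Rightarrow> real \<Rightarrow> real \<Rightarrow> real^3" where
  "rot_frame \<theta> p q r = vector [p * cos \<theta> - q * sin \<theta>, p * sin \<theta> + q * cos \<theta>, r]"

lemma norm_rot_frame: "norm (rot_frame \<theta> p q r) = sqrt (p\<^sup>2 + q\<^sup>2 + r\<^sup>2)"
proof -
  have "(p * cos \<theta> - q * sin \<theta>)\<^sup>2 + (p * sin \<theta> + q * cos \<theta>)\<^sup>2
      = (p\<^sup>2 + q\<^sup>2) * ((sin \<theta>)\<^sup>2 + (cos \<theta>)\<^sup>2)"
    by algebra
  then show ?thesis
    by (simp add: rot_frame_def norm_eq_sqrt_inner inner_vec_def sum_3 flip: power2_eq_square)
qed

text \<open>The frame is orthonormal and positively oriented, so the standard coordinate formula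
  carries over. Only the e_z coordinate needs sin^2 + cos^2 = 1; the other two are linear in the
  frame vectors.\<close>

lemma cross3_rot_frame:
  "cross3 (rot_frame \<theta> p q r) (rot_frame \<theta> p' q' r') =
    rot_frame \<theta> (q * r' - r * q') (r * p' - p * r') (p * q' - q * p')"
proof -
  have "(p * cos \<theta> - q * sin \<theta>) * (p' * sin \<theta> + q' * cos \<theta>) -
      (p * sin \<theta> + q * cos \<theta>) * (p' * cos \<theta> - q' * sin \<theta>)
      = (p * q' - q * p') * ((sin \<theta>)\<^sup>2 + (cos \<theta>)\<^sup>2)"
    by algebra
  then show ?thesis
    by (simp add: rot_frame_def cross3_def vec_eq_iff forall_3 algebra_simps)
qed

lemma inner_rot_frame:
  "rot_frame \<theta> p q r \<bullet> rot_frame \<theta> p' q' r' = p * p' + q * q' + r * r'"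
proof -
  have "(p * cos \<theta> - q * sin \<theta>) * (p' * cos \<theta> - q' * sin \<theta>) +
      (p * sin \<theta> + q * cos \<theta>) * (p' * sin \<theta> + q' * cos \<theta>)
      = (p * p' + q * q') * ((sin \<theta>)\<^sup>2 + (cos \<theta>)\<^sup>2)"
    by algebra
  then show ?thesis
    by (simp add: rot_frame_def inner_vec_def sum_3)
qed

text \<open>The determinant is the triple product of its rows, to which the two rules above
  apply.\<close>

lemma det_rot_frame:
  "det (vector [rot_frame \<theta> p q r, rot_frame \<theta> p' q' r', rot_frame \<theta> p'' q'' r''] :: real^3^3) =
    p * (q' * r'' - r' * q'') + q * (r' * p'' - p' * r'') + r * (p' * q'' - q' * p'')"
  by (simp add: cross3_rot_frame inner_rot_frame flip: dot_cross_det)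

section \<open>Differentiation in the frame and of the angle integral\<close>

lemma has_vector_derivative_vector_3:
  fixes x y z :: "real \<Rightarrow> real"
  assumes "(x has_real_derivative x') (at t)"
    and "(y has_real_derivative y') (at t)"
    and "(z has_real_derivative z') (at t)"
  shows "((\<lambda>u. vector [x u, y u, z u] :: real^3) has_vector_derivative vector [x', y', z']) (at t)"
proof -
  have vec: "vector [x, y, z] = x *\<^sub>R axis 1 1 + y *\<^sub>R axis 2 1 + z *\<^sub>R (axis 3 1 :: real^3)"
    for x y z :: real
    by (simp add: vec_eq_iff forall_3 axis_def)
  have "((\<lambda>u. f u *\<^sub>R v) has_vector_derivative f' *\<^sub>R v) (at t)"
    if "(f has_real_derivative f') (at t)" for f :: "real \<Rightarrow> real" and f' and v :: "real^3"
    using has_vector_derivative_scaleR[OF that has_vector_derivative_const[of v]] by simp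
  from has_vector_derivative_add[OF has_vector_derivative_add[OF this[OF assms(1)]
      this[OF assms(2)]] this[OF assms(3)]]
  show ?thesis
    unfolding vec .
qed

text \<open>Product rule with e_r' = \<omega> e_\<theta> and e_\<theta>' = -\<omega> e_r.\<close>

lemma has_vector_derivative_rot_frame:
  assumes "(\<theta> has_real_derivative \<omega>) (at t)"
    and "(p has_real_derivative p') (at t)"
    and "(q has_real_derivative q') (at t)"
    and "(r has_real_derivative r') (at t)"
  shows "((\<lambda>u. rot_frame (\<theta> u) (p u) (q u) (r u)) has_vector_derivative
    rot_frame (\<theta> t) (p' - \<omega> * q t) (q' + \<omega> * p t) r') (at t)"
  unfolding rot_frame_def
  by (intro has_vector_derivative_vector_3 assms(4))
    (rule derivative_eq_intros assms refl | simp add: algebra_simps)+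

lemma smooth_on_has_deriv:
  assumes "smooth_on A h" "x \<in> A"
  shows "((deriv ^^ n) h has_real_derivative (deriv ^^ Suc n) h x) (at x)"
  using assms by (simp add: smooth_on_def DERIV_deriv_iff_real_differentiable)

text \<open>A derivative at \<open>t\<close> depends on the previous derivative near
  \<open>t\<close>, not only at \<open>t\<close>; hence the formula for the latter is assumed on the
  whole open set \<open>J\<close>.\<close>

lemma vderiv_funpow_eqI:
  assumes "open J" "t \<in> J"
    and "\<And>u. u \<in> J \<Longrightarrow> (vderiv ^^ n) \<alpha> u = \<beta> u"
    and "(\<beta> has_vector_derivative v) (at t)"
  shows "(vderiv ^^ Suc n) \<alpha> t = v"
proof -
  have "((vderiv ^^ n) \<alpha> has_vector_derivative v) (at t)"
    using assms by (intro has_vector_derivative_transform_within_open[OF assms(4,1,2)]) simp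
  then show ?thesis
    by (simp add: vderiv_def vector_derivative_at)
qed

text \<open>The fundamental theorem of calculus gives a derivative within a compact interval.
  Choosing that interval inside \<open>J\<close> with \<open>t\<close> in its interior makes the
  derivative two-sided; \<open>t\<close> may lie on either side of \<open>t\<^sub>0\<close>.\<close>

lemma has_real_derivative_LBINT:
  fixes h :: "real \<Rightarrow> real"
  assumes "open J" "is_interval J" "t\<^sub>0 \<in> J" "t \<in> J" "continuous_on J h"
  shows "((\<lambda>u. LBINT \<xi>=ereal t\<^sub>0..ereal u. h \<xi>) has_real_derivative h t) (at t)"
proof -
  have "min t\<^sub>0 t \<in> J" "max t\<^sub>0 t \<in> J"
    using assms by (auto simp: min_def max_def)
  then obtain d e where "d > 0" "ball (min t\<^sub>0 t) d \<subseteq> J" "e > 0" "ball (max t\<^sub>0 t) e \<subseteq> J"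
    using \<open>open J\<close> by (meson openE)
  \<comment> \<open>Half of each radius stays inside the ball while moving strictly beyond both
    \<open>t\<^sub>0\<close> and \<open>t\<close>.\<close>
  define l r where "l = min t\<^sub>0 t - d / 2" and "r = max t\<^sub>0 t + e / 2"
  have lr: "l < t\<^sub>0" "l < t" "t\<^sub>0 < r" "t < r"
    using \<open>d > 0\<close> \<open>e > 0\<close> by (auto simp: l_def r_def)
  have "l \<in> ball (min t\<^sub>0 t) d" "r \<in> ball (max t\<^sub>0 t) e"
    using \<open>d > 0\<close> \<open>e > 0\<close> by (simp_all add: l_def r_def dist_real_def)
  then have "l \<in> J" "r \<in> J"
    using \<open>ball (min t\<^sub>0 t) d \<subseteq> J\<close> \<open>ball (max t\<^sub>0 t) e \<subseteq> J\<close> by blast+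
  have "{l..r} \<subseteq> J"
    by (intro subsetI mem_is_interval_1_I[OF \<open>is_interval J\<close> \<open>l \<in> J\<close> \<open>r \<in> J\<close>]) simp_all
  then have "((\<lambda>u. LBINT \<xi>=ereal t\<^sub>0..ereal u. h \<xi>) has_vector_derivative h t) (at t within {l..r})"
    using lr continuous_on_subset[OF assms(5)] by (intro interval_integral_FTC2) simp_all
  moreover have "at t within {l..r} = at t"
    using lr by (intro at_within_interior) simp
  ultimately show ?thesis
    by (simp add: has_real_derivative_iff_has_vector_derivative)
qed

text \<open>At a zero of \<open>f\<close> the parallel collapses to a point of the axis, so the
  differential would kill the direction \<open>(0, 1)\<close>. This justifies every later division
  by \<open>f\<close>.\<close>

lemma immersion_on_rot_surface_nonzero:
  assumes "immersion_on (I \<times> UNIV) (rot_surface f g)" "x \<in> I"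
  shows "f x \<noteq> 0"
proof
  assume "f x = 0"
  obtain D where D: "(rot_surface f g has_derivative D) (at (x, 0))" "inj D"
    using assms by (auto simp: immersion_on_def)
  have "((\<lambda>v. (x, v)) has_derivative (\<lambda>v. (0, v))) (at (0::real))"
    by (auto intro!: derivative_eq_intros)
  then have "((\<lambda>v. rot_surface f g (x, v)) has_derivative (\<lambda>v. D (0, v))) (at 0)"
    using D(1) by (rule has_derivative_compose)
  moreover have "(\<lambda>v. rot_surface f g (x, v)) = (\<lambda>v. vector [0, 0, g x])"
    using \<open>f x = 0\<close> by (simp add: rot_surface_def)
  ultimately have "(\<lambda>v. D (0, v)) = (\<lambda>v. 0)"
    by (metis has_derivative_const has_derivative_unique)
  then have "D (0, 1) = D (0, 0)"
    by metis
  with \<open>inj D\<close> show False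
    by (auto dest: injD)
qed

text \<open>The computation produces g'^3 in the denominator of the torsion, whereas (1 -
  f'^2)^(3/2) equals |g'|^3. The stated formula therefore holds for g' > 0 and changes sign for g' <
  0; \<open>nondeg\<close> excludes g' = 0, where the denominators vanish.\<close>

theorem proposition1:
  fixes f g s \<theta> :: "real \<Rightarrow> real" and \<alpha> :: "real \<Rightarrow> real^3"
    and I J :: "real set" and \<psi> \<epsilon> a b c t\<^sub>0 t :: real
  assumes I: "open I" "is_interval I"
    and smooth: "smooth_on I f" "smooth_on I g"
    and arc_length: "\<And>u. u \<in> I \<Longrightarrow> (deriv f u)\<^sup>2 + (deriv g u)\<^sup>2 = 1"
    and immersion: "immersion_on (I \<times> UNIV) (rot_surface f g)"
    and \<psi>: "\<psi> \<in> {0..pi}" and \<epsilon>: "\<epsilon> = 1 \<or> \<epsilon> = -1"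
    and a: "a = cos \<psi>" and b: "b = \<epsilon> * sin \<psi>"
    and J: "open J" "is_interval J" "t\<^sub>0 \<in> J"
    and s: "s = (\<lambda>u. cos \<psi> * u + c)" and s_J: "s ` J \<subseteq> I"
    and \<theta>: "\<theta> = (\<lambda>u. \<epsilon> * sin \<psi> * (LBINT \<xi>=ereal t\<^sub>0..ereal u. 1 / f (s \<xi>)))"
    and \<alpha>: "\<alpha> = (\<lambda>u. rot_surface f g (s u, \<theta> u))"
    and t: "t \<in> J"
    and nondeg: "(deriv f (s t))\<^sup>2 \<noteq> 1"
  shows
    "let F = f (s t); F1 = deriv f (s t); F2 = (deriv ^^ 2) f (s t); F3 = (deriv ^^ 3) f (s t);
         \<kappa> = curvature \<alpha> t;
         T = - (a * b / (\<kappa>\<^sup>2 * F ^ 3 * (1 - F1\<^sup>2) powr (3 / 2))) *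
               (- b\<^sup>2 * (1 - F1\<^sup>2)\<^sup>2 * (b\<^sup>2 + a\<^sup>2 * F1\<^sup>2)
                + a\<^sup>2 * F * F2 * (1 - F1\<^sup>2) * (3 * b\<^sup>2 + (a\<^sup>2 - 2 * b\<^sup>2) * F1\<^sup>2)
                + a\<^sup>2 * F\<^sup>2 * F2\<^sup>2 * (- 2 * a\<^sup>2 + b\<^sup>2 + 3 * a\<^sup>2 * F1\<^sup>2)
                - a ^ 4 * F ^ 3 * F2 ^ 3
                + a\<^sup>2 * F\<^sup>2 * F1 * F3 * (1 - F1\<^sup>2))
     in \<kappa> = sqrt (a ^ 4 * F2\<^sup>2 / (1 - F1\<^sup>2) + (b ^ 4 + a\<^sup>2 * b\<^sup>2 * F1\<^sup>2) / F\<^sup>2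
                    - 2 * a\<^sup>2 * b\<^sup>2 * F2 / F) \<and>
        (deriv g (s t) > 0 \<longrightarrow> torsion \<alpha> t = T) \<and>
        (deriv g (s t) < 0 \<longrightarrow> torsion \<alpha> t = - T)"
proof -

  \<comment> \<open>Derivatives of the profile curve and the arc-length relations\<close>
  define f1 f2 f3 g1 g2 g3 where "f1 = deriv f" and "f2 = (deriv ^^ 2) f" and "f3 = (deriv ^^ 3) f"
    and "g1 = deriv g" and "g2 = (deriv ^^ 2) g" and "g3 = (deriv ^^ 3) g"
  note defs = f1_def f2_def f3_def g1_def g2_def g3_def
  have df: "(f has_real_derivative f1 x) (at x)" "(f1 has_real_derivative f2 x) (at x)"
      "(f2 has_real_derivative f3 x) (at x)"
    and dg: "(g has_real_derivative g1 x) (at x)" "(g1 has_real_derivative g2 x) (at x)"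
      "(g2 has_real_derivative g3 x) (at x)" if "x \<in> I" for x
    using that smooth_on_has_deriv[OF smooth(1), of x 0] smooth_on_has_deriv[OF smooth(1), of x 1]
      smooth_on_has_deriv[OF smooth(1), of x 2] smooth_on_has_deriv[OF smooth(2), of x 0]
      smooth_on_has_deriv[OF smooth(2), of x 1] smooth_on_has_deriv[OF smooth(2), of x 2]
    by (simp_all add: defs numeral_2_eq_2 numeral_3_eq_3)
  have fg1: "(f1 x)\<^sup>2 + (g1 x)\<^sup>2 = 1" if "x \<in> I" for x
    using arc_length[OF that] by (simp add: defs)
  have fg2: "f1 x * f2 x + g1 x * g2 x = 0" if "x \<in> I" for x
  proof -
    have "((\<lambda>x. (f1 x)\<^sup>2 + (g1 x)\<^sup>2) has_real_derivative 2 * (f1 x * f2 x + g1 x * g2 x)) (at x)"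
      using df(2)[OF that] dg(2)[OF that]
      by (auto intro!: derivative_eq_intros simp: algebra_simps)
    \<comment> \<open>The expression is constant on the open set \<open>I\<close>, so its derivative
      is also 0; uniqueness of derivatives gives the relation.\<close>
    moreover have "((\<lambda>x. (f1 x)\<^sup>2 + (g1 x)\<^sup>2) has_real_derivative 0) (at x)"
      using fg1 I(1) that
      by (intro has_field_derivative_transform_within_open[OF DERIV_const[of 1]]) auto
    ultimately show ?thesis
      using DERIV_unique by fastforce
  qed
  have fg3: "(f2 x)\<^sup>2 + f1 x * f3 x + (g2 x)\<^sup>2 + g1 x * g3 x = 0" if "x \<in> I" for x
  proof -
    have "((\<lambda>x. f1 x * f2 x + g1 x * g2 x) has_real_derivative
        (f2 x)\<^sup>2 + f1 x * f3 x + (g2 x)\<^sup>2 + g1 x * g3 x) (at x)"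
      using df(2,3)[OF that] dg(2,3)[OF that]
      by (auto intro!: derivative_eq_intros simp: algebra_simps power2_eq_square)
    moreover have "((\<lambda>x. f1 x * f2 x + g1 x * g2 x) has_real_derivative 0) (at x)"
      using fg2 I(1) that
      by (intro has_field_derivative_transform_within_open[OF DERIV_const[of 0]]) auto
    ultimately show ?thesis
      using DERIV_unique by blast
  qed

  \<comment> \<open>Derivatives of the loxodrome\<close>
  have sI: "s u \<in> I" if "u \<in> J" for u
    using that s_J by blast
  have f_nz: "f (s u) \<noteq> 0" if "u \<in> J" for u
    using immersion_on_rot_surface_nonzero[OF immersion sI[OF that]] .
  have ds: "(s has_real_derivative a) (at u)" for u
    unfolding s a by (auto intro!: derivative_eq_intros)
  \<comment> \<open>Each differentiation of a profile function along the curve contributes a factor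
    \<open>a\<close>, the constant speed of \<open>s\<close>.\<close>
  have dh: "((\<lambda>u. h (s u)) has_real_derivative a * h') (at u)"
    if "(h has_real_derivative h') (at (s u))" for h h' u
    using DERIV_chain2[OF that ds] by (simp add: mult.commute)
  have d\<theta>: "(\<theta> has_real_derivative b / f (s u)) (at u)" if "u \<in> J" for u
  proof -
    have "isCont (\<lambda>u. f (s u)) u" if "u \<in> J" for u
      using dh[OF df(1)[OF sI[OF that]]] by (rule DERIV_isCont)
    then have "continuous_on J (\<lambda>\<xi>. 1 / f (s \<xi>))"
      using f_nz by (auto intro!: continuous_intros continuous_at_imp_continuous_on)
    from DERIV_cmult[OF has_real_derivative_LBINT[OF J that this], of b] show ?thesis
      unfolding \<theta> b by simp
  qed

  have \<alpha>0: "\<alpha> u = rot_frame (\<theta> u) (f (s u)) 0 (g (s u))" for u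
    by (simp add: \<alpha> rot_surface_def rot_frame_def)
  \<comment> \<open>The e_\<theta> coordinate arises solely from the rotation, as (b / f) * f =
    b.\<close>
  have \<alpha>1: "(vderiv ^^ 1) \<alpha> u = rot_frame (\<theta> u) (a * f1 (s u)) b (a * g1 (s u))" if "u \<in> J" for u
    unfolding One_nat_def
  proof (rule vderiv_funpow_eqI[OF J(1) that])
    show "((\<lambda>u. rot_frame (\<theta> u) (f (s u)) 0 (g (s u))) has_vector_derivative
        rot_frame (\<theta> u) (a * f1 (s u)) b (a * g1 (s u))) (at u)"
      using has_vector_derivative_rot_frame[OF d\<theta>[OF that] dh[OF df(1)[OF sI[OF that]]]
          DERIV_const[of 0] dh[OF dg(1)[OF sI[OF that]]]] f_nz[OF that] by simp
  qed (simp add: \<alpha>0)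
  have \<alpha>2: "(vderiv ^^ 2) \<alpha> u =
      rot_frame (\<theta> u) (a\<^sup>2 * f2 (s u) - b\<^sup>2 / f (s u)) (a * b * f1 (s u) / f (s u)) (a\<^sup>2 * g2 (s u))"
    if "u \<in> J" for u
  proof -
    have "((\<lambda>u. rot_frame (\<theta> u) (a * f1 (s u)) b (a * g1 (s u))) has_vector_derivative
        rot_frame (\<theta> u) (a\<^sup>2 * f2 (s u) - b\<^sup>2 / f (s u)) (a * b * f1 (s u) / f (s u)) (a\<^sup>2 * g2 (s u)))
        (at u)"
      using has_vector_derivative_rot_frame[OF d\<theta>[OF that]
          DERIV_cmult[OF dh[OF df(2)[OF sI[OF that]]], of a]
          DERIV_const[of b] DERIV_cmult[OF dh[OF dg(2)[OF sI[OF that]]], of a]]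
      by (simp add: power2_eq_square ac_simps)
    from vderiv_funpow_eqI[OF J(1) that \<alpha>1 this] show ?thesis
      by (simp only: Suc_1)
  qed
  have \<alpha>3: "(vderiv ^^ 3) \<alpha> u =
      rot_frame (\<theta> u) (a ^ 3 * f3 (s u))
        ((2 * a\<^sup>2 * b * f2 (s u)) / f (s u) - (a\<^sup>2 * b * (f1 (s u))\<^sup>2 + b ^ 3) / (f (s u))\<^sup>2)
        (a ^ 3 * g3 (s u))"
    if "u \<in> J" for u
  proof -
    note nz = f_nz[OF that]
    note ders = dh[OF df(1)[OF sI[OF that]]] dh[OF df(2)[OF sI[OF that]]]
      dh[OF df(3)[OF sI[OF that]]] dh[OF dg(3)[OF sI[OF that]]]
    have "((\<lambda>u. a\<^sup>2 * f2 (s u) - b\<^sup>2 / f (s u)) has_real_derivative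
        a ^ 3 * f3 (s u) + a * b\<^sup>2 * f1 (s u) / (f (s u))\<^sup>2) (at u)"
      by (rule derivative_eq_intros ders nz refl)+
        (use nz in \<open>simp add: field_simps power2_eq_square power3_eq_cube\<close>)
    moreover have "((\<lambda>u. a * b * f1 (s u) / f (s u)) has_real_derivative
        a\<^sup>2 * b * (f2 (s u) / f (s u) - (f1 (s u))\<^sup>2 / (f (s u))\<^sup>2)) (at u)"
      by (rule derivative_eq_intros ders nz refl)+
        (use nz in \<open>simp add: field_simps power2_eq_square\<close>)
    moreover have "((\<lambda>u. a\<^sup>2 * g2 (s u)) has_real_derivative a ^ 3 * g3 (s u)) (at u)"
      by (rule derivative_eq_intros ders refl)+ (simp add: power2_eq_square power3_eq_cube)
    ultimately have "((\<lambda>u. rot_frame (\<theta> u) (a\<^sup>2 * f2 (s u) - b\<^sup>2 / f (s u))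
        (a * b * f1 (s u) / f (s u)) (a\<^sup>2 * g2 (s u))) has_vector_derivative
        rot_frame (\<theta> u)
          (a ^ 3 * f3 (s u) + a * b\<^sup>2 * f1 (s u) / (f (s u))\<^sup>2 -
            b / f (s u) * (a * b * f1 (s u) / f (s u)))
          (a\<^sup>2 * b * (f2 (s u) / f (s u) - (f1 (s u))\<^sup>2 / (f (s u))\<^sup>2) +
            b / f (s u) * (a\<^sup>2 * f2 (s u) - b\<^sup>2 / f (s u)))
          (a ^ 3 * g3 (s u))) (at u)"
      by (rule has_vector_derivative_rot_frame[OF d\<theta>[OF that]])
    note vderiv_funpow_eqI[OF J(1) that \<alpha>2 this]
    \<comment> \<open>In the e_r coordinate, the term from differentiating -b^2 / f cancels exactly
      against the rotation term.\<close>
    moreover have "a ^ 3 * f3 (s u) + a * b\<^sup>2 * f1 (s u) / (f (s u))\<^sup>2 -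
          b / f (s u) * (a * b * f1 (s u) / f (s u)) = a ^ 3 * f3 (s u)"
      by (simp add: power2_eq_square)
    moreover have "a\<^sup>2 * b * (f2 (s u) / f (s u) - (f1 (s u))\<^sup>2 / (f (s u))\<^sup>2) +
          b / f (s u) * (a\<^sup>2 * f2 (s u) - b\<^sup>2 / f (s u)) =
        (2 * a\<^sup>2 * b * f2 (s u)) / f (s u) - (a\<^sup>2 * b * (f1 (s u))\<^sup>2 + b ^ 3) / (f (s u))\<^sup>2"
      using nz by (simp add: field_simps power2_eq_square power3_eq_cube)
    ultimately show ?thesis
      by simp
  qed

  \<comment> \<open>Values at the fixed parameter \<open>t\<close> and the relations among
    them\<close>
  define F F1 F2 F3 G1 G2 G3 where "F = f (s t)" and "F1 = f1 (s t)" and "F2 = f2 (s t)"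
    and "F3 = f3 (s t)" and "G1 = g1 (s t)" and "G2 = g2 (s t)" and "G3 = g3 (s t)"
  note Defs = F_def F1_def F2_def F3_def G1_def G2_def G3_def
  have "F \<noteq> 0"
    using f_nz[OF t] by (simp add: Defs)
  have rel: "1 - F1\<^sup>2 = G1\<^sup>2" "F1 * F2 + G1 * G2 = 0" "F2\<^sup>2 + F1 * F3 + G2\<^sup>2 + G1 * G3 = 0"
    using fg1[OF sI[OF t]] fg2[OF sI[OF t]] fg3[OF sI[OF t]] by (auto simp: Defs)
  have "G1 \<noteq> 0"
    using nondeg rel(1) by (auto simp: Defs defs)
  have ab: "a\<^sup>2 + b\<^sup>2 = 1"
    using \<epsilon> by (auto simp: a b)

  let ?\<kappa> = "curvature \<alpha> t"
  \<comment> \<open>\<open>E\<close> is the radicand of the curvature formula with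
    \<open>G1\<^sup>2\<close> in place of \<open>1 - F1\<^sup>2\<close>; \<open>P\<close> is the
    bracket of the torsion formula.\<close>
  define E where "E = a ^ 4 * F2\<^sup>2 / G1\<^sup>2 + (b ^ 4 + a\<^sup>2 * b\<^sup>2 * F1\<^sup>2) / F\<^sup>2 - 2 * a\<^sup>2 * b\<^sup>2 * F2 / F"
  define P where "P = - b\<^sup>2 * (1 - F1\<^sup>2)\<^sup>2 * (b\<^sup>2 + a\<^sup>2 * F1\<^sup>2)
    + a\<^sup>2 * F * F2 * (1 - F1\<^sup>2) * (3 * b\<^sup>2 + (a\<^sup>2 - 2 * b\<^sup>2) * F1\<^sup>2)
    + a\<^sup>2 * F\<^sup>2 * F2\<^sup>2 * (- 2 * a\<^sup>2 + b\<^sup>2 + 3 * a\<^sup>2 * F1\<^sup>2)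
    - a ^ 4 * F ^ 3 * F2 ^ 3
    + a\<^sup>2 * F\<^sup>2 * F1 * F3 * (1 - F1\<^sup>2)"
  have v1: "vderiv \<alpha> t = rot_frame (\<theta> t) (a * F1) b (a * G1)"
    using \<alpha>1[OF t] by (simp add: Defs)
  have v2: "(vderiv ^^ 2) \<alpha> t =
      rot_frame (\<theta> t) (a\<^sup>2 * F2 - b\<^sup>2 / F) (a * b * F1 / F) (a\<^sup>2 * G2)"
    using \<alpha>2[OF t] by (simp add: Defs)
  have v3: "(vderiv ^^ 3) \<alpha> t = rot_frame (\<theta> t) (a ^ 3 * F3)
      ((2 * a\<^sup>2 * b * F2) / F - (a\<^sup>2 * b * F1\<^sup>2 + b ^ 3) / F\<^sup>2) (a ^ 3 * G3)"
    using \<alpha>3[OF t] by (simp add: Defs)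
  \<comment> \<open>By \<open>rel(2)\<close>, (F2, G2) is orthogonal to the unit vector (F1, G1),
    hence a multiple of (G1, -F1); \<open>y\<close> is the factor, which up to sign is the curvature
    of the profile curve.\<close>
  define y where "y = F2 / G1"
  have y: "F2 = y * G1" "G2 = - F1 * y"
    using rel(2) \<open>G1 \<noteq> 0\<close> by (auto simp: y_def field_simps eq_neg_iff_add_eq_0)
  have G1G3: "G1 * G3 = - y\<^sup>2 - F1 * F3"
    using rel(1,3) y by algebra
  have "(a * F1)\<^sup>2 + b\<^sup>2 + (a * G1)\<^sup>2 = 1"
    using rel(1) ab by algebra
  then have unit: "norm (vderiv \<alpha> t) = 1"
    by (simp add: v1 norm_rot_frame)

  \<comment> \<open>Curvature\<close>
  have \<kappa>: "norm (cross3 (vderiv \<alpha> t) ((vderiv ^^ 2) \<alpha> t)) = sqrt E"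
  proof -
    \<comment> \<open>Unit speed makes the acceleration orthogonal to the velocity, so the norm of
      their cross product is that of the acceleration alone.\<close>
    have "vderiv \<alpha> t \<bullet> (vderiv ^^ 2) \<alpha> t = a ^ 3 * (F1 * F2 + G1 * G2)"
      by (simp add: v1 v2 inner_rot_frame algebra_simps power2_eq_square power3_eq_cube)
    then have "norm (cross3 (vderiv \<alpha> t) ((vderiv ^^ 2) \<alpha> t)) = norm ((vderiv ^^ 2) \<alpha> t)"
      using norm_cross_dot[of "vderiv \<alpha> t" "(vderiv ^^ 2) \<alpha> t"] by (simp add: rel(2) unit)
    moreover have "(a\<^sup>2 * F2 - b\<^sup>2 / F)\<^sup>2 + (a * b * F1 / F)\<^sup>2 + (a\<^sup>2 * G2)\<^sup>2 = E"
    proof -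
      \<comment> \<open>Both F2^2 + G2^2 and F2^2 / G1^2 equal y^2; this removes g'' from the norm
        of the acceleration.\<close>
      have "F2\<^sup>2 + G2\<^sup>2 = y\<^sup>2"
        using rel(1) y by algebra
      moreover have "F2\<^sup>2 / G1\<^sup>2 = y\<^sup>2"
        by (simp add: y_def power_divide)
      ultimately have E: "E = a ^ 4 * (F2\<^sup>2 + G2\<^sup>2) +
          (b ^ 4 + a\<^sup>2 * b\<^sup>2 * F1\<^sup>2) / F\<^sup>2 - 2 * a\<^sup>2 * b\<^sup>2 * F2 / F"
        by (simp add: E_def flip: times_divide_eq_right)
      show ?thesis
        unfolding E using \<open>F \<noteq> 0\<close> by (simp add: field_simps eval_nat_numeral)
    qed
    then have "norm ((vderiv ^^ 2) \<alpha> t) = sqrt E"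
      by (simp add: v2 norm_rot_frame)
    ultimately show ?thesis
      by simp
  qed
  have \<kappa>_eq: "?\<kappa> = sqrt E"
    by (simp add: curvature_def \<kappa> unit)

  \<comment> \<open>Torsion and its sign\<close>
  have det_eq: "det (vector [vderiv \<alpha> t, (vderiv ^^ 2) \<alpha> t, (vderiv ^^ 3) \<alpha> t] :: real^3^3) =
      - (a * b * P / (F ^ 3 * G1 ^ 3))"
  proof -
    \<comment> \<open>These substitutions make all coordinates polynomial, so that the Groebner basis method applies.\<close>
    define x z where "x = b / F\<^sup>2" and "z = (F3 + F1 * y\<^sup>2) / G1"
    have xyz: "b = x * F\<^sup>2" "F2 = y * G1" "G2 = - F1 * y" "F3 = z * G1 - F1 * y\<^sup>2"
      using \<open>F \<noteq> 0\<close> \<open>G1 \<noteq> 0\<close> y by (auto simp: x_def z_def)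
    \<comment> \<open>\<open>z\<close> is the derivative of f'' / g' at \<open>s t\<close>. The
      formulas for \<open>F3\<close> and \<open>G3\<close> are what differentiating f'' = y g' and
      g'' = -f' y yields.\<close>
    have "G1 * G3 = G1 * (- F1 * z - G1 * y\<^sup>2)"
      using G1G3 rel(1) xyz(4) by algebra
    then have G3: "G3 = - F1 * z - G1 * y\<^sup>2"
      using \<open>G1 \<noteq> 0\<close> by simp
    have FG: "F1\<^sup>2 + G1\<^sup>2 = 1"
      using rel(1) by simp
    have coords: "b\<^sup>2 / F = x\<^sup>2 * F ^ 3" "a * b * F1 / F = a * x * F * F1"
        "(2 * a\<^sup>2 * b * F2) / F - (a\<^sup>2 * b * F1\<^sup>2 + b ^ 3) / F\<^sup>2 =
          2 * a\<^sup>2 * x * F * F2 - a\<^sup>2 * x * F1\<^sup>2 - x ^ 3 * F ^ 4"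
      using \<open>F \<noteq> 0\<close> unfolding xyz(1) by (simp_all add: field_simps eval_nat_numeral)
    \<comment> \<open>This is the determinant in frame coordinates cleared of the denominators of
      the claim. After substitution it is a polynomial identity modulo \<open>FG\<close> and
      \<open>ab\<close>.\<close>
    have "F ^ 3 * G1 ^ 3 * (a * F1 * (a * x * F * F1 * (a ^ 3 * G3) - a\<^sup>2 * G2 *
            (2 * a\<^sup>2 * x * F * F2 - a\<^sup>2 * x * F1\<^sup>2 - x ^ 3 * F ^ 4)) +
          b * (a\<^sup>2 * G2 * (a ^ 3 * F3) - (a\<^sup>2 * F2 - x\<^sup>2 * F ^ 3) * (a ^ 3 * G3)) +
          a * G1 * ((a\<^sup>2 * F2 - x\<^sup>2 * F ^ 3) *
            (2 * a\<^sup>2 * x * F * F2 - a\<^sup>2 * x * F1\<^sup>2 - x ^ 3 * F ^ 4) -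
            a * x * F * F1 * (a ^ 3 * F3)))
        = - (a * b * P)"
      using FG ab unfolding P_def rel(1) xyz G3 by algebra
    then show ?thesis
      unfolding v1 v2 v3 det_rot_frame coords using \<open>F \<noteq> 0\<close> \<open>G1 \<noteq> 0\<close> by (simp add: field_simps)
  qed
  \<comment> \<open>If the curvature is 0, both sides are 0 by the convention x / 0 = 0.\<close>
  have tau: "torsion \<alpha> t = - (a * b / (?\<kappa>\<^sup>2 * F ^ 3 * G1 ^ 3)) * P"
    unfolding torsion_def det_eq \<kappa> \<kappa>_eq by simp
  \<comment> \<open>The real power sees only the absolute value of \<open>G1\<close>, which is where
    the sign of g' is lost.\<close>
  have "(1 - F1\<^sup>2) powr (3 / 2) = \<bar>G1\<bar> ^ 3"
  proof -
    have "(1 - F1\<^sup>2) powr (3 / 2) = (\<bar>G1\<bar> powr 2) powr (3 / 2)"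
      using \<open>G1 \<noteq> 0\<close> by (simp add: rel(1))
    also have "\<dots> = \<bar>G1\<bar> ^ 3"
      using \<open>G1 \<noteq> 0\<close> by (simp only: powr_powr) simp
    finally show ?thesis .
  qed
  then have "(G1 > 0 \<longrightarrow> torsion \<alpha> t = - (a * b / (?\<kappa>\<^sup>2 * F ^ 3 * (1 - F1\<^sup>2) powr (3 / 2))) * P) \<and>
      (G1 < 0 \<longrightarrow> torsion \<alpha> t = - (- (a * b / (?\<kappa>\<^sup>2 * F ^ 3 * (1 - F1\<^sup>2) powr (3 / 2))) * P))"
    unfolding tau by (auto simp: power3_eq_cube)
  with \<kappa>_eq[unfolded E_def rel(1)[symmetric]] show ?thesis
    unfolding Let_def P_def Defs defs by (rule conjI)
qed

end
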